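(* Let $\bar z$ be any accumulation point of an infinite sequence $\{z^k\}$ generated by the SRPA algorithm. Then $$\Theta'(\bar z;d)\ge0\quad\text{for all }d\in\mathbb{R}^{\bar N}.$$
   Context: Setting. Let $L,n,N_1,\dots,N_L$ be positive integers, $\bar N_0=0$, $\bar N_\ell=\sum_{j=1}^{\ell}N_j$, $\bar N=n+\bar N_L$. Write $z=(\theta^\top,u_1^\top,\dots,u_L^\top)^\top\in\mathbb{R}^{\bar N}$, $\theta\in\mathbb{R}^n$, $u_\ell\in\mathbb{R}^{N_\ell}$, $u=(u_1^\top,\dots,u_L^\top)^\top$. Let $g:\mathbb{R}^{\bar N_L}\to\mathbb{R}_+$ and $\psi_{\ell-1}:\mathbb{R}^{n+\bar N_{\ell-1}}\to\mathbb{R}^{N_\ell}$ be locally Lipschitz and twice directionally differentiable (i.e. the limits $f'(x;d)=\lim_{\tau\downarrow0}\frac{f(x+\tau d)-f(x)}{\tau}$ and $f^{(2)}(x;d)=\lim_{\tau\downarrow0}\frac{f(x+\tau d)-f(x)-\tau f'(x;d)}{\tau^2/2}$ exist for all $x,d$), $\lambda>0$, $\beta_\ell>0$, and $$F(z)=g(u)+\lambda\|\theta\|^2,\quad \Theta(z)=F(z)+\sum_{\ell=1}^L\beta_\ell\|u_\ell-\psi_{\ell-1}(\theta,u_1,\dots,u_{\ell-1})\|_1 .$$ "Smooth" means differentiable with locally Lipschitz gradient. A function is piecewise affine if its domain is a finite union of polyhedral sets on each of which it is affine. Assume moreover that $g$ is smooth and every component of every $\psi_{\ell-1}$ is either smooth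 or piecewise affine. Then $\Theta$ is written as $\Theta(z)=F(z)+H(z)+\sum_{j\in\mathcal J}|c_j(z)|$ with $H:\mathbb{R}^{\bar N}\to\mathbb{R}_+$ continuous piecewise affine, $c_j:\mathbb{R}^{\bar N}\to\mathbb{R}$ smooth, $\mathcal J=\{1,\dots,J\}$, $0\le J\le\bar N_L$ (components with piecewise affine $\psi$ are collected in $H$, the others in the $c_j$); fix this decomposition. Fix finitely many nonempty, mutually distinct polyhedra $P_1,\dots,P_I$ with $\bigcup_{i\in[I]}P_i=\mathbb{R}^{\bar N}$ such that $H$ is affine on each $P_i$. The function $\Theta$ is level-bounded. Notation: $\|\cdot\|$ Euclidean norm; $\mathbf d(z,P)=\inf_{y\in P}\|z-y\|$; $\mathcal A^\delta(z)=\{i\in[I]:\mathbf d(z,P_i)\le\delta\}$. SRPA algorithm. Input: $z^1\in\mathbb{R}^{\bar N}$, $\rho_1>0$, $\eta_1\in(0,1)$, $\eta_2>1$, $\delta>0$. For $k=1,2,\dots$: with $$\Phi_k(s)=F(z^k)+\nabla F(z^k)^\top s+H(z^k+s)+\sum_{j\in\mathcal J}|c_j(z^k)+\nabla c_j(z^k)^\top s|+\frac{\rho_k}{2}\|s\|^2,$$ for each $i\in\mathcal A^\delta(z^k)$ let $s^{k,i}$ be the minimizer of $\Phi_k$ over $\{z-z^k:z\in P_i\}$; let $s^k$ be one of the $s^{k,i}$, $i\in\mathcal A^\delta(z^k)$, with the smallest value of $\Phi_k$. If $\Phi_k(s^k)=\Phi_k(\mathbf 0)$, terminate and output $z^k$.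 Otherwise, set $(z^{k+1},\rho_{k+1})=(z^k+s^k,\rho_k)$ if $\Theta(z^k)-\Theta(z^k+s^k)\ge\frac{\eta_1\rho_k}{2}\|s^k\|^2$, and $(z^{k+1},\rho_{k+1})=(z^k,\eta_2\rho_k)$ otherwise. *)

theory Defs
  imports "HOL-Analysis.Analysis"
begin

section \<open>Regularity notions\<close>

definition locally_lipschitz :: "('a::metric_space \<Rightarrow> 'b::metric_space) \<Rightarrow> bool" where
  "locally_lipschitz f \<longleftrightarrow> (\<forall>x. \<exists>e>0. \<exists>C. C-lipschitz_on (ball x e) f)"

definition has_dir_deriv ::
    "('a::real_normed_vector \<Rightarrow> 'b::real_normed_vector) \<Rightarrow> 'a \<Rightarrow> 'a \<Rightarrow> 'b \<Rightarrow> bool" where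
  "has_dir_deriv f x d D \<longleftrightarrow>
     ((\<lambda>\<tau>. (f (x + \<tau> *\<^sub>R d) - f x) /\<^sub>R \<tau>) \<longlongrightarrow> D) (at_right 0)"

definition dir_deriv ::
    "('a::real_normed_vector \<Rightarrow> 'b::real_normed_vector) \<Rightarrow> 'a \<Rightarrow> 'a \<Rightarrow> 'b" where
  "dir_deriv f x d = (THE D. has_dir_deriv f x d D)"

definition has_dir_deriv2 ::
    "('a::real_normed_vector \<Rightarrow> 'b::real_normed_vector) \<Rightarrow> 'a \<Rightarrow> 'a \<Rightarrow> 'b \<Rightarrow> bool" where
  "has_dir_deriv2 f x d D \<longleftrightarrow>
     ((\<lambda>\<tau>. (f (x + \<tau> *\<^sub>R d) - f x - \<tau> *\<^sub>R dir_deriv f x d) /\<^sub>R (\<tau>\<^sup>2 / 2)) \<longlongrightarrow> D)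
       (at_right 0)"

definition twice_dir_differentiable ::
    "('a::real_normed_vector \<Rightarrow> 'b::real_normed_vector) \<Rightarrow> bool" where
  "twice_dir_differentiable f \<longleftrightarrow>
     (\<forall>x d. (\<exists>D. has_dir_deriv f x d D) \<and> (\<exists>D. has_dir_deriv2 f x d D))"

definition grad :: "('a::real_inner \<Rightarrow> real) \<Rightarrow> 'a \<Rightarrow> 'a" where
  "grad f x = (THE D. GDERIV f x :> D)"

definition smooth :: "('a::euclidean_space \<Rightarrow> real) \<Rightarrow> bool" where
  "smooth f \<longleftrightarrow> (\<forall>x. f differentiable (at x)) \<and> locally_lipschitz (grad f)"

definition affine_fun_on ::
    "('a::real_vector) set \<Rightarrow> ('a \<Rightarrow> 'b::real_vector) \<Rightarrow> bool" where
  "affine_fun_on S f \<longleftrightarrow> (\<exists>A b. linear A \<and> (\<forall>x\<in>S. f x = A x + b))"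

definition piecewise_affine :: "('a::euclidean_space \<Rightarrow> 'b::real_vector) \<Rightarrow> bool" where
  "piecewise_affine f \<longleftrightarrow>
     (\<exists>\<P>. finite \<P> \<and> \<Union>\<P> = UNIV \<and> (\<forall>P\<in>\<P>. polyhedron P \<and> affine_fun_on P f))"

definition level_bounded :: "('a::metric_space \<Rightarrow> real) \<Rightarrow> bool" where
  "level_bounded f \<longleftrightarrow> (\<forall>\<alpha>. bounded {x. f x \<le> \<alpha>})"

definition accumulation_point :: "(nat \<Rightarrow> 'a::topological_space) \<Rightarrow> 'a \<Rightarrow> bool" where
  "accumulation_point x l \<longleftrightarrow> (\<exists>r. strict_mono r \<and> (\<lambda>k. x (r k)) \<longlonglongrightarrow> l)"

section \<open>Layered variables\<close>

text \<open>
  The variable \<open>z = (\<theta>, u\<^sub>1, \<dots>, u\<^sub>L)\<close> is a pair \<open>(\<theta>, u)\<close> of type \<open>(real^'n) \<times> (real^'m)\<close>, whose norm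
  is the Euclidean norm of the stacked vector. The layers are given by a map \<open>lay\<close> that assigns to
  each coordinate of \<open>u\<close> the layer in \<open>{1..L}\<close> to which it belongs, so that \<open>N\<^sub>\<ell>\<close> is the cardinality
  of \<open>{i. lay i = \<ell>}\<close>. The space of layer \<open>\<ell>\<close> is identified with the vectors of \<open>real^'m\<close> that vanish
  at the coordinates outside that layer.
\<close>

definition layer_part :: "('m::finite \<Rightarrow> nat) \<Rightarrow> nat \<Rightarrow> real^'m \<Rightarrow> real^'m" where
  "layer_part lay l u = (\<chi> i. if lay i = l then u $ i else 0)"

definition norm1 :: "real^'m::finite \<Rightarrow> real" where
  "norm1 v = (\<Sum>i\<in>UNIV. \<bar>v $ i\<bar>)"

text \<open>
  \<open>f\<close> represents a map of the variables \<open>\<theta>, u\<^sub>1, \<dots>, u\<^bsub>\<ell>-1\<^esub>\<close> with values in the space of layer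
  \<open>\<ell>\<close>: it is constant in the remaining variables, and its values vanish outside that layer. Local
  Lipschitz continuity, directional differentiability, smoothness and piecewise affinity of such an
  \<open>f\<close> mean the same as for the map of \<open>\<theta>, u\<^sub>1, \<dots>, u\<^bsub>\<ell>-1\<^esub>\<close> alone.
\<close>

definition layer_function ::
    "('m::finite \<Rightarrow> nat) \<Rightarrow> nat \<Rightarrow> ((real^'n::finite) \<times> (real^'m) \<Rightarrow> real^'m) \<Rightarrow> bool" where
  "layer_function lay l f \<longleftrightarrow>
     (\<forall>\<theta> u v. (\<forall>i. lay i < l \<longrightarrow> u $ i = v $ i) \<longrightarrow> f (\<theta>, u) = f (\<theta>, v)) \<and>
     (\<forall>z i. lay i \<noteq> l \<longrightarrow> f z $ i = 0)"

section \<open>The algorithm\<close>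

definition active_pieces :: "(nat \<Rightarrow> 'a::metric_space set) \<Rightarrow> nat \<Rightarrow> real \<Rightarrow> 'a \<Rightarrow> nat set" where
  "active_pieces P I \<delta> z = {i \<in> {1..I}. infdist z (P i) \<le> \<delta>}"

definition srpa_model ::
    "('a::euclidean_space \<Rightarrow> real) \<Rightarrow> ('a \<Rightarrow> real) \<Rightarrow> nat \<Rightarrow> (nat \<Rightarrow> 'a \<Rightarrow> real) \<Rightarrow>
     'a \<Rightarrow> real \<Rightarrow> 'a \<Rightarrow> real" where
  "srpa_model F H J c z \<rho> s =
     F z + grad F z \<bullet> s + H (z + s) + (\<Sum>j=1..J. \<bar>c j z + grad (c j) z \<bullet> s\<bar>)
       + \<rho> / 2 * (norm s)\<^sup>2"

text \<open>
  \<open>z\<close> and \<open>\<rho>\<close> are the iterates and proximal parameters, indexed from 1, of a run that never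
  terminates; \<open>t i\<close> is the solution of the subproblem on the piece \<open>P i\<close> and \<open>s\<close> the selected step.
\<close>

definition srpa_infinite_run ::
    "('a::euclidean_space \<Rightarrow> real) \<Rightarrow> ('a \<Rightarrow> real) \<Rightarrow> nat \<Rightarrow> (nat \<Rightarrow> 'a \<Rightarrow> real) \<Rightarrow> ('a \<Rightarrow> real) \<Rightarrow>
     (nat \<Rightarrow> 'a set) \<Rightarrow> nat \<Rightarrow> real \<Rightarrow> real \<Rightarrow> real \<Rightarrow> (nat \<Rightarrow> 'a) \<Rightarrow> (nat \<Rightarrow> real) \<Rightarrow> bool" where
  "srpa_infinite_run F H J c \<Theta> P I \<eta>\<^sub>1 \<eta>\<^sub>2 \<delta> z \<rho> \<longleftrightarrow>
     0 < \<rho> 1 \<and> 0 < \<eta>\<^sub>1 \<and> \<eta>\<^sub>1 < 1 \<and> 1 < \<eta>\<^sub>2 \<and> 0 < \<delta> \<and>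
     (\<forall>k\<ge>1. \<exists>t s. let \<Phi> = srpa_model F H J c (z k) (\<rho> k); A = active_pieces P I \<delta> (z k) in
        (\<forall>i\<in>A. is_arg_min \<Phi> (\<lambda>s. s \<in> (\<lambda>y. y - z k) ` P i) (t i)) \<and>
        (\<exists>i\<in>A. s = t i \<and> (\<forall>i'\<in>A. \<Phi> s \<le> \<Phi> (t i'))) \<and>
        \<Phi> s \<noteq> \<Phi> 0 \<and>
        (if \<Theta> (z k) - \<Theta> (z k + s) \<ge> \<eta>\<^sub>1 * \<rho> k / 2 * (norm s)\<^sup>2
         then z (k + 1) = z k + s \<and> \<rho> (k + 1) = \<rho> k
         else z (k + 1) = z k \<and> \<rho> (k + 1) = \<eta>\<^sub>2 * \<rho> k))"

end

theory Submission
  imports Defs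
begin

text \<open>
  On bounded sets the model differs from \<open>\<Theta>\<close> by the proximal term up to an error of order
  \<open>\<parallel>s\<parallel>\<^sup>2\<close>, because \<open>F\<close> and the \<open>c\<^sub>j\<close> have locally Lipschitz gradients. The iterates and the trial
  points stay bounded, so every step with a large proximal parameter is successful; hence \<open>\<rho>\<^sub>k\<close>
  is bounded, it converges, and only finitely many steps fail. The sufficient decrease then forces
  \<open>s\<^sup>k \<longlonglongrightarrow> 0\<close>. Passing to the limit in the minimality of \<open>s\<^sup>k\<close> shows that the model at an accumulation
  point is minimal at the origin along every piece containing that point, and these pieces cover a
  neighbourhood of it. To first order in \<open>s\<close> the model and \<open>\<Theta>\<close> agree.
\<close>

section \<open>Smooth functions\<close>

lemma locally_lipschitz_compose:
  assumes f: "locally_lipschitz f" and g: "locally_lipschitz g"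
  shows "locally_lipschitz (\<lambda>x. g (f x))"
  unfolding locally_lipschitz_def
proof
  fix x
  obtain e C where e: "e > 0" "C-lipschitz_on (ball x e) f"
    using f unfolding locally_lipschitz_def by blast
  obtain e' C' where e': "e' > 0" "C'-lipschitz_on (ball (f x) e') g"
    using g unfolding locally_lipschitz_def by blast
  have "continuous_on (ball x e) f"
    using e(2) by (rule lipschitz_on_continuous_on)
  then have "isCont f x"
    using e(1) by (simp add: continuous_on_eq_continuous_at)
  then obtain d where d: "d > 0" "f ` ball x d \<subseteq> ball (f x) e'"
    using e'(1) unfolding continuous_at_ball by blast
  have "C-lipschitz_on (ball x (min d e)) f"
    using e(2) by (rule lipschitz_on_subset) auto
  moreover have "C'-lipschitz_on (f ` ball x (min d e)) g"
    using e'(2) by (rule lipschitz_on_subset) (use d in auto)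
  ultimately have "(C' * C)-lipschitz_on (ball x (min d e)) (\<lambda>x. g (f x))"
    by (rule lipschitz_on_compose2)
  then show "\<exists>e>0. \<exists>C. C-lipschitz_on (ball x e) (\<lambda>x. g (f x))"
    using d(1) e(1) by (intro exI[of _ "min d e"]) auto
qed

lemma locally_lipschitz_Pair:
  assumes f: "locally_lipschitz f" and g: "locally_lipschitz g"
  shows "locally_lipschitz (\<lambda>x. (f x, g x))"
  unfolding locally_lipschitz_def
proof
  fix x
  obtain e C where e: "e > 0" "C-lipschitz_on (ball x e) f"
    using f unfolding locally_lipschitz_def by blast
  obtain e' C' where e': "e' > 0" "C'-lipschitz_on (ball x e') g"
    using g unfolding locally_lipschitz_def by blast
  have "C-lipschitz_on (ball x (min e e')) f" "C'-lipschitz_on (ball x (min e e')) g"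
    using e(2) e'(2) by (auto elim: lipschitz_on_subset)
  then have "(sqrt (C\<^sup>2 + C'\<^sup>2))-lipschitz_on (ball x (min e e')) (\<lambda>x. (f x, g x))"
    by (rule lipschitz_on_Pair)
  then show "\<exists>e>0. \<exists>C. C-lipschitz_on (ball x e) (\<lambda>x. (f x, g x))"
    using e(1) e'(1) by (intro exI[of _ "min e e'"]) auto
qed

lemma lipschitz_imp_locally_lipschitz: "C-lipschitz_on UNIV f \<Longrightarrow> locally_lipschitz f"
  unfolding locally_lipschitz_def by (meson lipschitz_on_subset subset_UNIV zero_less_one)

lemma bounded_linear_imp_locally_lipschitz: "bounded_linear f \<Longrightarrow> locally_lipschitz f"
  by (metis bounded_linear.lipschitz_boundE lipschitz_imp_locally_lipschitz)

lemma locally_lipschitz_continuous_on: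
  assumes "locally_lipschitz f"
  shows "continuous_on S f"
proof -
  have "isCont f x" for x
  proof -
    obtain e C where e: "e > 0" "C-lipschitz_on (ball x e) f"
      using assms unfolding locally_lipschitz_def by blast
    have "continuous_on (ball x e) f"
      using e(2) by (rule lipschitz_on_continuous_on)
    then show ?thesis
      using e(1) by (simp add: continuous_on_eq_continuous_at)
  qed
  then show ?thesis
    by (simp add: continuous_at_imp_continuous_on)
qed

lemma locally_lipschitz_compact:
  assumes f: "locally_lipschitz f" and K: "compact K"
  obtains C where "C-lipschitz_on K f"
proof -
  \<comment> \<open>\<open>local_lipschitz\<close> concerns families indexed by time. The constant
    family over the single time 0 lets the compactness theorem for such families apply to
    \<open>f\<close>.\<close>
  have "local_lipschitz {0::real} K (\<lambda>_. f)"
  proof (rule local_lipschitzI)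
    fix x assume "x \<in> K"
    obtain e C where e: "e > 0" "C-lipschitz_on (ball x e) f"
      using f unfolding locally_lipschitz_def by blast
    then have "C-lipschitz_on (cball x (e/2) \<inter> K) f"
      by (elim lipschitz_on_subset) auto
    then show "\<exists>u>0. \<exists>L. \<forall>t\<in>cball t u \<inter> {0}. L-lipschitz_on (cball x u \<inter> K) f" for t :: real
      using e(1) by (intro exI[of _ "e/2"]) auto
  qed
  then obtain C where "C-lipschitz_on K f"
    using local_lipschitz_compact_implies_lipschitz[OF _ K, of "{0::real}" "\<lambda>_. f"] by auto
  then show ?thesis ..
qed

section \<open>Gradients and the quadratic error of linearization\<close>

lemma GDERIV_unique:
  assumes "GDERIV f x :> D" "GDERIV f x :> D'"
  shows "D = D'"
proof -
  have "(\<lambda>h. h \<bullet> D) = (\<lambda>h. h \<bullet> D')"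
    using assms unfolding gderiv_def by (rule has_derivative_unique)
  then show ?thesis
    by (metis inner_commute vector_eq_ldot)
qed

lemma grad_eqI: "GDERIV f x :> D \<Longrightarrow> grad f x = D"
  unfolding grad_def using GDERIV_unique by blast

lemma smoothI:
  assumes "\<And>x. GDERIV f x :> G x" "locally_lipschitz G"
  shows "smooth f"
proof -
  have "grad f = G"
    using assms(1) grad_eqI by blast
  then show ?thesis
    using assms unfolding smooth_def gderiv_def differentiable_def by auto
qed

text \<open>\<open>grad\<close> is a definite description, so it is meaningful only once some
  gradient is exhibited. In finite dimension the Riesz vector of the derivative is read off from its
  values on the basis.\<close>

lemma smooth_GDERIV:
  fixes f :: "'a::euclidean_space \<Rightarrow> real"
  assumes "smooth f"
  shows "GDERIV f x :> grad f x"
proof -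
  obtain f' where f': "(f has_derivative f') (at x)"
    using assms unfolding smooth_def differentiable_def by blast
  interpret f': bounded_linear f'
    using f' by (rule has_derivative_bounded_linear)
  have "f' h = h \<bullet> (\<Sum>b\<in>Basis. f' b *\<^sub>R b)" for h
  proof -
    have "f' h = f' (\<Sum>b\<in>Basis. (h \<bullet> b) *\<^sub>R b)"
      by (simp add: euclidean_representation)
    also have "\<dots> = (\<Sum>b\<in>Basis. (h \<bullet> b) * f' b)"
      by (simp add: f'.sum f'.scaleR)
    finally show ?thesis
      by (simp add: inner_sum_right mult.commute)
  qed
  then have "f' = (\<lambda>h. h \<bullet> (\<Sum>b\<in>Basis. f' b *\<^sub>R b))" ..
  with f' have "GDERIV f x :> (\<Sum>b\<in>Basis. f' b *\<^sub>R b)"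
    unfolding gderiv_def by simp
  then show ?thesis
    using grad_eqI by metis
qed

lemma smooth_continuous_on: "smooth f \<Longrightarrow> continuous_on S f"
  unfolding smooth_def
  by (meson continuous_at_imp_continuous_on differentiable_imp_continuous_within)

lemma smooth_continuous_on_grad: "smooth f \<Longrightarrow> continuous_on S (grad f)"
  unfolding smooth_def using locally_lipschitz_continuous_on by blast

text \<open>The gradient has one Lipschitz constant on the compact ball. By convexity the segment
  from \<open>x\<close> to \<open>x + s\<close> stays in the ball, and there the gradient varies by
  at most \<open>M * norm s\<close>; the mean value inequality supplies the second factor
  \<open>norm s\<close>.\<close>

lemma smooth_linearization_error:
  fixes f :: "'a::euclidean_space \<Rightarrow> real"
  assumes f: "smooth f"
  obtains M where "0 \<le> M" "\<And>x s. \<lbrakk>x \<in> cball 0 R; x + s \<in> cball 0 R\<rbrakk> \<Longrightarrow>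
    \<bar>f (x + s) - (f x + grad f x \<bullet> s)\<bar> \<le> M * (norm s)\<^sup>2"
proof -
  obtain M where M: "M-lipschitz_on (cball 0 R) (grad f)"
    using locally_lipschitz_compact f unfolding smooth_def by (metis compact_cball)
  have "\<bar>f (x + s) - (f x + grad f x \<bullet> s)\<bar> \<le> M * (norm s)\<^sup>2"
    if x: "x \<in> cball 0 R" "x + s \<in> cball 0 R" for x s
  proof -
    have "norm (f (x + s) - f x - (x + s - x) \<bullet> grad f x) \<le> norm (x + s - x) * (M * norm s)"
    proof (rule differentiable_bound_linearization[where S = "closed_segment x (x + s)"
          and f' = "\<lambda>x h. h \<bullet> grad f x"])
      show "x + t *\<^sub>R (x + s - x) \<in> closed_segment x (x + s)" if "t \<in> {0..1}" for t
        using that by (auto simp: in_segment algebra_simps)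
      show "(f has_derivative (\<lambda>h. h \<bullet> grad f y)) (at y within closed_segment x (x + s))" for y
        using smooth_GDERIV[OF f, of y] unfolding gderiv_def by (rule has_derivative_at_withinI)
      fix y assume y: "y \<in> closed_segment x (x + s)"
      then have "y \<in> cball 0 R"
        using x by (metis closed_segment_subset convex_cball subsetD)
      then have "norm (grad f y - grad f x) \<le> M * norm (y - x)"
        using M x by (metis dist_norm lipschitz_onD)
      also have "norm (y - x) \<le> norm s"
        using segment_bound1[OF y] by simp
      finally have "norm (grad f y - grad f x) \<le> M * norm s"
        using lipschitz_on_nonneg[OF M] by (simp add: mult_left_mono)
      then have "norm (h \<bullet> (grad f y - grad f x)) \<le> M * norm s * norm h" for h
        by (metis Cauchy_Schwarz_ineq2 mult.commute mult_left_mono norm_ge_zero order_trans real_norm_def)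
      then show "onorm ((\<lambda>h. h \<bullet> grad f y) - (\<lambda>h. h \<bullet> grad f x)) \<le> M * norm s"
        by (intro onorm_le) (auto simp: inner_diff_right)
    qed simp
    then show ?thesis
      by (simp add: power2_eq_square inner_commute algebra_simps)
  qed
  then show ?thesis
    using that lipschitz_on_nonneg[OF M] by blast
qed

section \<open>Directional derivatives\<close>

lemma has_derivative_imp_has_dir_deriv:
  fixes f :: "'a::real_normed_vector \<Rightarrow> real"
  assumes "(f has_derivative f') (at x)"
  shows "has_dir_deriv f x d (f' d)"
proof -
  have "((\<lambda>\<tau>. f (x + \<tau> *\<^sub>R d)) has_derivative (\<lambda>\<tau>. f' (\<tau> *\<^sub>R d))) (at 0)"
    by (rule has_derivative_compose[of "\<lambda>\<tau>. x + \<tau> *\<^sub>R d" "\<lambda>\<tau>. \<tau> *\<^sub>R d"])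
      (use assms in \<open>auto intro!: derivative_eq_intros\<close>)
  moreover have "(\<lambda>\<tau>. f' (\<tau> *\<^sub>R d)) = (*) (f' d)"
    using has_derivative_linear[OF assms] by (auto simp: linear_cmul)
  ultimately have "((\<lambda>\<tau>. f (x + \<tau> *\<^sub>R d)) has_real_derivative f' d) (at 0)"
    unfolding has_field_derivative_def by simp
  then have "((\<lambda>\<tau>. (f (x + \<tau> *\<^sub>R d) - f x) /\<^sub>R \<tau>) \<longlongrightarrow> f' d) (at 0)"
    unfolding DERIV_def by (simp add: divide_inverse mult.commute)
  then show ?thesis
    unfolding has_dir_deriv_def by (rule tendsto_within_subset) simp
qed

lemma has_dir_deriv_add:
  assumes "has_dir_deriv f x d D" "has_dir_deriv g x d E"
  shows "has_dir_deriv (\<lambda>x. f x + g x) x d (D + E)"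
  using tendsto_add[OF assms[unfolded has_dir_deriv_def]]
  unfolding has_dir_deriv_def by (simp add: algebra_simps)

lemma has_dir_deriv_sum:
  assumes "\<And>i. i \<in> A \<Longrightarrow> has_dir_deriv (f i) x d (D i)"
  shows "has_dir_deriv (\<lambda>x. \<Sum>i\<in>A. f i x) x d (\<Sum>i\<in>A. D i)"
  using tendsto_sum[of A "\<lambda>i \<tau>. (f i (x + \<tau> *\<^sub>R d) - f i x) /\<^sub>R \<tau>" D "at_right 0"] assms
  unfolding has_dir_deriv_def by (simp add: sum_subtractf flip: scaleR_right.sum)

lemma has_dir_deriv_bounded_linear:
  assumes "bounded_linear h" "has_dir_deriv f x d D"
  shows "has_dir_deriv (\<lambda>x. h (f x)) x d (h D)"
  using bounded_linear.tendsto[OF assms(1) assms(2)[unfolded has_dir_deriv_def]] 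
    linear_simps[OF assms(1)]
  unfolding has_dir_deriv_def by (simp)

text \<open>If \<open>f x\<close> is nonzero, \<open>f\<close> keeps its sign on a short initial
  part of the ray and the quotients agree up to sign. If \<open>f x = 0\<close>, the quotient of the
  absolute value is the absolute value of the quotient.\<close>

lemma has_dir_deriv_abs:
  fixes f :: "'a::real_normed_vector \<Rightarrow> real"
  assumes D: "has_dir_deriv f x d D"
  obtains E where "has_dir_deriv (\<lambda>x. \<bar>f x\<bar>) x d E"
proof -
  let ?q = "\<lambda>\<tau>. (f (x + \<tau> *\<^sub>R d) - f x) /\<^sub>R \<tau>"
  have q: "(?q \<longlongrightarrow> D) (at_right 0)"
    using D unfolding has_dir_deriv_def .
  have pos: "\<forall>\<^sub>F \<tau> in at_right (0::real). 0 < \<tau>"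
    by (simp add: eventually_at_right_less)
  \<comment> \<open>Convergence of the difference quotient already forces continuity of
    \<open>f\<close> along the ray; no continuity of \<open>f\<close> is assumed.\<close>
  have "((\<lambda>\<tau>. f x + \<tau> * ?q \<tau>) \<longlongrightarrow> f x + 0 * D) (at_right 0)"
    by (intro tendsto_intros q)
  moreover have "\<forall>\<^sub>F \<tau> in at_right 0. f x + \<tau> * ?q \<tau> = f (x + \<tau> *\<^sub>R d)"
    using pos by eventually_elim (simp add: field_simps)
  ultimately have lim: "((\<lambda>\<tau>. f (x + \<tau> *\<^sub>R d)) \<longlongrightarrow> f x) (at_right 0)"
    using Lim_transform_eventually by fastforce
  consider "f x > 0" | "f x < 0" | "f x = 0"
    by linarith
  then show ?thesis
  proof cases
    case 1
    have "\<forall>\<^sub>F \<tau> in at_right 0. 0 < f (x + \<tau> *\<^sub>R d)"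
      using lim 1 by (rule order_tendstoD)
    then have "\<forall>\<^sub>F \<tau> in at_right 0. ?q \<tau> = (\<bar>f (x + \<tau> *\<^sub>R d)\<bar> - \<bar>f x\<bar>) /\<^sub>R \<tau>"
      by eventually_elim (use 1 in simp)
    with q have "has_dir_deriv (\<lambda>x. \<bar>f x\<bar>) x d D"
      unfolding has_dir_deriv_def by (rule Lim_transform_eventually)
    then show ?thesis
      by (rule that)
  next
    case 2
    have "\<forall>\<^sub>F \<tau> in at_right 0. f (x + \<tau> *\<^sub>R d) < 0"
      using lim 2 by (rule order_tendstoD)
    then have "\<forall>\<^sub>F \<tau> in at_right 0. - ?q \<tau> = (\<bar>f (x + \<tau> *\<^sub>R d)\<bar> - \<bar>f x\<bar>) /\<^sub>R \<tau>"
      by eventually_elim (use 2 in \<open>simp add: algebra_simps\<close>)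
    with tendsto_minus[OF q] have "has_dir_deriv (\<lambda>x. \<bar>f x\<bar>) x d (- D)"
      unfolding has_dir_deriv_def by (rule Lim_transform_eventually)
    then show ?thesis
      by (rule that)
  next
    case 3
    have "\<forall>\<^sub>F \<tau> in at_right 0. \<bar>?q \<tau>\<bar> = (\<bar>f (x + \<tau> *\<^sub>R d)\<bar> - \<bar>f x\<bar>) /\<^sub>R \<tau>"
      using pos by eventually_elim (use 3 in \<open>simp add: abs_mult\<close>)
    with tendsto_rabs[OF q] have "has_dir_deriv (\<lambda>x. \<bar>f x\<bar>) x d \<bar>D\<bar>"
      unfolding has_dir_deriv_def by (rule Lim_transform_eventually)
    then show ?thesis
      by (rule that)
  qed
qed

section \<open>Linearizing a composite objective\<close>

text \<open>Separates the convergence analysis from the layers: \<open>z\<close> is a point of an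
  arbitrary Euclidean space here, and the layered structure returns only when the locale is
  interpreted.\<close>

locale composite_objective =
  fixes F H :: "'a::euclidean_space \<Rightarrow> real" and J :: nat and c :: "nat \<Rightarrow> 'a \<Rightarrow> real"
    and \<Theta> :: "'a \<Rightarrow> real"
  assumes smooth_F: "smooth F" and F_nonneg: "0 \<le> F x"
    and continuous_H: "continuous_on UNIV H" and H_nonneg: "0 \<le> H x"
    and smooth_c: "j \<in> {1..J} \<Longrightarrow> smooth (c j)"
    and objective_eq: "\<Theta> x = F x + H x + (\<Sum>j=1..J. \<bar>c j x\<bar>)"
begin

abbreviation model :: "'a \<Rightarrow> real \<Rightarrow> 'a \<Rightarrow> real" where
  "model \<equiv> srpa_model F H J c"

lemma objective_nonneg: "0 \<le> \<Theta> x"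
  unfolding objective_eq using F_nonneg[of x] H_nonneg[of x] by (simp add: sum_nonneg)

lemma model_0: "model x r 0 = \<Theta> x"
  by (simp add: srpa_model_def objective_eq)

text \<open>Nonnegativity of \<open>F\<close>, \<open>H\<close> and the absolute values leaves only
  the linear term, bounded by Cauchy-Schwarz, and the proximal term. The quadratic growth in
  \<open>s\<close> later bounds the steps.\<close>

lemma model_lower_bound: "r / 2 * (norm s)\<^sup>2 - norm (grad F x) * norm s \<le> model x r s"
proof -
  have "0 \<le> (\<Sum>j=1..J. \<bar>c j x + grad (c j) x \<bullet> s\<bar>)"
    by (simp add: sum_nonneg)
  moreover have "- (norm (grad F x) * norm s) \<le> grad F x \<bullet> s"
    using Cauchy_Schwarz_ineq2[of "grad F x" s] by linarith
  ultimately show ?thesis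
    unfolding srpa_model_def using F_nonneg[of x] H_nonneg[of "x + s"] by linarith
qed

text \<open>\<open>H\<close> is not linearized and cancels. The absolute value is 1-Lipschitz, so
  each \<open>c j\<close> contributes at most its linearization error, as does \<open>F\<close>.
  Since the proximal term is subtracted, \<open>M\<close> is uniform in \<open>r\<close>.\<close>

lemma model_error:
  obtains M where "0 \<le> M" "\<And>x s r. \<lbrakk>x \<in> cball 0 R; x + s \<in> cball 0 R\<rbrakk> \<Longrightarrow>
    \<bar>\<Theta> (x + s) - (model x r s - r / 2 * (norm s)\<^sup>2)\<bar> \<le> M * (norm s)\<^sup>2"
proof -
  obtain MF where MF: "0 \<le> MF" "\<And>x s. \<lbrakk>x \<in> cball 0 R; x + s \<in> cball 0 R\<rbrakk> \<Longrightarrow>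
      \<bar>F (x + s) - (F x + grad F x \<bullet> s)\<bar> \<le> MF * (norm s)\<^sup>2"
    using smooth_linearization_error[OF smooth_F] by blast
  have "\<exists>M\<ge>0. \<forall>x s. x \<in> cball 0 R \<longrightarrow> x + s \<in> cball 0 R \<longrightarrow>
      \<bar>c j (x + s) - (c j x + grad (c j) x \<bullet> s)\<bar> \<le> M * (norm s)\<^sup>2" if "j \<in> {1..J}" for j
    using smooth_linearization_error[OF smooth_c[OF that], of R] by metis
  then obtain m where m: "\<And>j. j \<in> {1..J} \<Longrightarrow> 0 \<le> m j"
    "\<And>j x s. \<lbrakk>j \<in> {1..J}; x \<in> cball 0 R; x + s \<in> cball 0 R\<rbrakk> \<Longrightarrow>
      \<bar>c j (x + s) - (c j x + grad (c j) x \<bullet> s)\<bar> \<le> m j * (norm s)\<^sup>2"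
    by metis
  let ?M = "MF + (\<Sum>j=1..J. m j)"
  have "\<bar>\<Theta> (x + s) - (model x r s - r / 2 * (norm s)\<^sup>2)\<bar> \<le> ?M * (norm s)\<^sup>2"
    if x: "x \<in> cball 0 R" "x + s \<in> cball 0 R" for x s r
  proof -
    let ?dc = "\<lambda>j. \<bar>c j (x + s)\<bar> - \<bar>c j x + grad (c j) x \<bullet> s\<bar>"
    have "\<bar>\<Sum>j=1..J. ?dc j\<bar> \<le> (\<Sum>j=1..J. m j * (norm s)\<^sup>2)"
    proof (rule sum_abs[THEN order_trans], rule sum_mono)
      show "\<bar>?dc j\<bar> \<le> m j * (norm s)\<^sup>2" if "j \<in> {1..J}" for j
        using m(2)[OF that x] by linarith
    qed
    moreover have "\<Theta> (x + s) - (model x r s - r / 2 * (norm s)\<^sup>2)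
        = F (x + s) - (F x + grad F x \<bullet> s) + (\<Sum>j=1..J. ?dc j)"
      by (simp add: srpa_model_def objective_eq sum_subtractf)
    moreover have "?M * (norm s)\<^sup>2 = MF * (norm s)\<^sup>2 + (\<Sum>j=1..J. m j * (norm s)\<^sup>2)"
      by (simp add: distrib_right sum_distrib_right)
    ultimately show ?thesis
      using MF(2)[OF x] by linarith
  qed
  moreover have "0 \<le> ?M"
    by (intro add_nonneg_nonneg sum_nonneg MF(1) m(1))
  ultimately show ?thesis
    using that by blast
qed

text \<open>Joint continuity in base point, parameter and step, through continuity of the gradients;
  it carries the minimality of the steps over to an accumulation point.\<close>

lemma tendsto_model:
  assumes x: "(x \<longlongrightarrow> x') A" and r: "(r \<longlongrightarrow> r') A" and s: "(s \<longlongrightarrow> s') A"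
  shows "((\<lambda>k. model (x k) (r k) (s k)) \<longlongrightarrow> model x' r' s') A"
proof -
  have H: "((\<lambda>k. H (x k + s k)) \<longlongrightarrow> H (x' + s')) A"
    by (rule continuous_on_tendsto_compose[OF continuous_H]) (auto intro: tendsto_add x s)
  have f: "((\<lambda>k. f (x k)) \<longlongrightarrow> f x') A" "((\<lambda>k. grad f (x k)) \<longlongrightarrow> grad f x') A"
    if "smooth f" for f
    using continuous_on_tendsto_compose[OF smooth_continuous_on[OF that, of UNIV] x]
      continuous_on_tendsto_compose[OF smooth_continuous_on_grad[OF that, of UNIV] x] by auto
  show ?thesis
    unfolding srpa_model_def
    by (intro tendsto_intros H f smooth_F smooth_c r s) auto
qed

text \<open>Replacing the model by \<open>\<Theta>\<close> costs a term of order
  \<open>\<tau>\<^sup>2\<close>, which after division by \<open>\<tau>\<close> vanishes in the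
  limit.\<close>

lemma model_local_min_imp_dir_deriv_nonneg:
  assumes min: "\<forall>\<^sub>F \<tau> in at_right 0. \<Theta> x \<le> model x r (\<tau> *\<^sub>R d)"
    and D: "has_dir_deriv \<Theta> x d D"
  shows "0 \<le> D"
proof -
  \<comment> \<open>This radius contains \<open>x + \<tau> *\<^sub>R d\<close> for all
    \<open>\<tau>\<close> in the unit interval.\<close>
  define R where "R = norm x + norm d"
  obtain M where M: "0 \<le> M" "\<And>x s r. \<lbrakk>x \<in> cball 0 R; x + s \<in> cball 0 R\<rbrakk> \<Longrightarrow>
      \<bar>\<Theta> (x + s) - (model x r s - r / 2 * (norm s)\<^sup>2)\<bar> \<le> M * (norm s)\<^sup>2"
    using model_error by metis
  let ?K = "(M + r / 2) * (norm d)\<^sup>2"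
  have "\<forall>\<^sub>F \<tau> in at_right 0. 0 < \<tau> \<and> \<tau> < (1::real)"
    using eventually_at_right_real[of 0 "1::real"] by simp
  then have "\<forall>\<^sub>F \<tau> in at_right 0. - (\<tau> * ?K) \<le> (\<Theta> (x + \<tau> *\<^sub>R d) - \<Theta> x) /\<^sub>R \<tau>"
    using min
  proof eventually_elim
    case (elim \<tau>)
    have "norm (x + \<tau> *\<^sub>R d) \<le> norm x + \<tau> * norm d"
      using norm_triangle_ineq[of x "\<tau> *\<^sub>R d"] elim by simp
    also have "\<dots> \<le> R"
      unfolding R_def using elim by (simp add: mult_left_le_one_le)
    finally have "x + \<tau> *\<^sub>R d \<in> cball 0 R" by simp
    moreover have "x \<in> cball 0 R"
      by (simp add: R_def)
    ultimately have "\<Theta> x - \<Theta> (x + \<tau> *\<^sub>R d) \<le> (M + r / 2) * (norm (\<tau> *\<^sub>R d))\<^sup>2"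
      using M(2)[of x "\<tau> *\<^sub>R d" r] elim by (auto simp: algebra_simps)
    moreover have "(M + r / 2) * (norm (\<tau> *\<^sub>R d))\<^sup>2 = \<tau> * (\<tau> * ?K)"
      by (simp add: power_mult_distrib power2_eq_square)
    ultimately have "- (\<tau> * (\<tau> * ?K)) \<le> \<Theta> (x + \<tau> *\<^sub>R d) - \<Theta> x"
      by linarith
    then show ?case
      using elim by (simp add: field_simps)
  qed
  moreover have "((\<lambda>\<tau>. - (\<tau> * ?K)) \<longlongrightarrow> - (0 * ?K)) (at_right 0)"
    by (intro tendsto_intros)
  ultimately have "- (0 * ?K) \<le> D"
    using tendsto_le[OF trivial_limit_at_right_real D[unfolded has_dir_deriv_def]] by blast
  then show ?thesis by simp
qed

end

section \<open>Behaviour of the iterates\<close>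

locale srpa_run = composite_objective F H J c \<Theta>
  for F H :: "'a::euclidean_space \<Rightarrow> real" and J c \<Theta> +
  fixes P :: "nat \<Rightarrow> 'a set" and I :: nat and \<eta>\<^sub>1 \<eta>\<^sub>2 \<delta> :: real
    and z :: "nat \<Rightarrow> 'a" and \<rho> :: "nat \<Rightarrow> real"
  assumes closed_P: "i \<in> {1..I} \<Longrightarrow> closed (P i)"
    and P_cover: "(\<Union>i\<in>{1..I}. P i) = UNIV"
    and level_bounded: "level_bounded \<Theta>"
    and run: "srpa_infinite_run F H J c \<Theta> P I \<eta>\<^sub>1 \<eta>\<^sub>2 \<delta> z \<rho>"
begin

section \<open>Choosing one trial step per iteration\<close>

lemma parameters: "0 < \<rho> 1" "0 < \<eta>\<^sub>1" "\<eta>\<^sub>1 < 1" "1 < \<eta>\<^sub>2" "0 < \<delta>"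
  using run unfolding srpa_infinite_run_def by auto

text \<open>The selected step beats the minimizer of every active piece, hence every point of every
  active piece. In this form the auxiliary minimizers \<open>t\<close> disappear.\<close>

lemma step_exists:
  assumes "1 \<le> k"
  shows "\<exists>s. (\<forall>i\<in>active_pieces P I \<delta> (z k). \<forall>y\<in>P i. model (z k) (\<rho> k) s \<le> model (z k) (\<rho> k) (y - z k)) \<and>
      model (z k) (\<rho> k) s \<noteq> model (z k) (\<rho> k) 0 \<and>
      (if \<Theta> (z k) - \<Theta> (z k + s) \<ge> \<eta>\<^sub>1 * \<rho> k / 2 * (norm s)\<^sup>2
       then z (k + 1) = z k + s \<and> \<rho> (k + 1) = \<rho> k
       else z (k + 1) = z k \<and> \<rho> (k + 1) = \<eta>\<^sub>2 * \<rho> k)"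
proof -
  obtain t s where ts: "let \<Phi> = model (z k) (\<rho> k); A = active_pieces P I \<delta> (z k) in
        (\<forall>i\<in>A. is_arg_min \<Phi> (\<lambda>s. s \<in> (\<lambda>y. y - z k) ` P i) (t i)) \<and>
        (\<exists>i\<in>A. s = t i \<and> (\<forall>i'\<in>A. \<Phi> s \<le> \<Phi> (t i'))) \<and>
        \<Phi> s \<noteq> \<Phi> 0 \<and>
        (if \<Theta> (z k) - \<Theta> (z k + s) \<ge> \<eta>\<^sub>1 * \<rho> k / 2 * (norm s)\<^sup>2
         then z (k + 1) = z k + s \<and> \<rho> (k + 1) = \<rho> k
         else z (k + 1) = z k \<and> \<rho> (k + 1) = \<eta>\<^sub>2 * \<rho> k)"
    using run assms unfolding srpa_infinite_run_def by blast
  have "model (z k) (\<rho> k) s \<le> model (z k) (\<rho> k) (y - z k)"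
    if i: "i \<in> active_pieces P I \<delta> (z k)" and y: "y \<in> P i" for i y
  proof -
    have "model (z k) (\<rho> k) s \<le> model (z k) (\<rho> k) (t i)"
      using ts i unfolding Let_def by blast
    also have "\<dots> \<le> model (z k) (\<rho> k) (y - z k)"
      using ts i y unfolding Let_def is_arg_min_def by (meson image_eqI not_less)
    finally show ?thesis .
  qed
  with ts show ?thesis
    unfolding Let_def by blast
qed

text \<open>A run only asserts that a suitable step exists for each \<open>k\<close>, so one is
  fixed by choice. At index 0 the value is arbitrary, since runs start at 1.\<close>

definition step :: "nat \<Rightarrow> 'a" where
  "step k = (SOME s.
      (\<forall>i\<in>active_pieces P I \<delta> (z k). \<forall>y\<in>P i. model (z k) (\<rho> k) s \<le> model (z k) (\<rho> k) (y - z k)) \<and>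
      model (z k) (\<rho> k) s \<noteq> model (z k) (\<rho> k) 0 \<and>
      (if \<Theta> (z k) - \<Theta> (z k + s) \<ge> \<eta>\<^sub>1 * \<rho> k / 2 * (norm s)\<^sup>2
       then z (k + 1) = z k + s \<and> \<rho> (k + 1) = \<rho> k
       else z (k + 1) = z k \<and> \<rho> (k + 1) = \<eta>\<^sub>2 * \<rho> k))"

definition successful :: "nat \<Rightarrow> bool" where
  "successful k \<longleftrightarrow> \<Theta> (z k) - \<Theta> (z k + step k) \<ge> \<eta>\<^sub>1 * \<rho> k / 2 * (norm (step k))\<^sup>2"

context
  fixes k :: nat
  assumes k: "1 \<le> k"
begin

lemma step_minimal:
  "\<lbrakk>i \<in> active_pieces P I \<delta> (z k); y \<in> P i\<rbrakk> \<Longrightarrow>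
    model (z k) (\<rho> k) (step k) \<le> model (z k) (\<rho> k) (y - z k)"
  and step_model_neq: "model (z k) (\<rho> k) (step k) \<noteq> \<Theta> (z k)"
  and step_successful: "successful k \<Longrightarrow> z (Suc k) = z k + step k \<and> \<rho> (Suc k) = \<rho> k"
  and step_unsuccessful: "\<not> successful k \<Longrightarrow> z (Suc k) = z k \<and> \<rho> (Suc k) = \<eta>\<^sub>2 * \<rho> k"
  using someI_ex[OF step_exists[OF k], folded step_def]
  unfolding successful_def model_0 by (auto split: if_splits)

text \<open>The pieces cover the space, so some active piece contains \<open>z k\<close> and the
  zero step competes in the minimization. Strictness is the failure of the termination test.\<close>

lemma step_decrease: "model (z k) (\<rho> k) (step k) < \<Theta> (z k)"
proof -
  obtain i where i: "i \<in> {1..I}" "z k \<in> P i"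
    using P_cover by blast
  then have "i \<in> active_pieces P I \<delta> (z k)"
    using parameters(5) by (simp add: active_pieces_def)
  then have "model (z k) (\<rho> k) (step k) \<le> \<Theta> (z k)"
    using step_minimal[of i "z k"] i(2) by (simp add: model_0)
  then show ?thesis
    using step_model_neq by simp
qed

end

section \<open>Monotonicity and boundedness along the run\<close>

lemma proximal_pos: "1 \<le> k \<Longrightarrow> 0 < \<rho> k"
  by (induction k rule: dec_induct)
    (use parameters step_successful step_unsuccessful in \<open>simp, metis less_trans mult_pos_pos zero_less_one\<close>)

lemma proximal_mono_Suc: "1 \<le> k \<Longrightarrow> \<rho> k \<le> \<rho> (Suc k)"
  using proximal_pos[of k] parameters(4) step_successful[of k] step_unsuccessful[of k]
  by (cases "successful k") auto

lemma objective_decrease_Suc: "1 \<le> k \<Longrightarrow> \<Theta> (z (Suc k)) \<le> \<Theta> (z k)"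
proof (cases "successful k")
  case True
  assume k: "1 \<le> k"
  have "0 \<le> \<eta>\<^sub>1 * \<rho> k / 2 * (norm (step k))\<^sup>2"
    using proximal_pos[OF k] parameters(2) by simp
  then show ?thesis
    using True step_successful[OF k True] unfolding successful_def by simp
qed (simp add: step_unsuccessful)

lemma proximal_ge: "1 \<le> k \<Longrightarrow> \<rho> 1 \<le> \<rho> k"
  by (induction k rule: dec_induct) (use proximal_mono_Suc in \<open>auto intro: order_trans\<close>)

lemma objective_le: "1 \<le> k \<Longrightarrow> \<Theta> (z k) \<le> \<Theta> (z 1)"
  by (induction k rule: dec_induct) (use objective_decrease_Suc in \<open>auto intro: order_trans\<close>)

text \<open>The iterates lie in a level set of \<open>\<Theta>\<close>. A rejected trial point need
  not, so the steps are bounded separately, by comparing the quadratic lower bound of the model with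
  its decrease.\<close>

lemma bounded_iterates:
  obtains R where "\<And>k. 1 \<le> k \<Longrightarrow> z k \<in> cball 0 R" "\<And>k. 1 \<le> k \<Longrightarrow> z k + step k \<in> cball 0 R"
proof -
  have "bounded {x. \<Theta> x \<le> \<Theta> (z 1)}"
    using level_bounded unfolding level_bounded_def by blast
  then obtain R where "\<And>x. \<Theta> x \<le> \<Theta> (z 1) \<Longrightarrow> norm x \<le> R"
    unfolding bounded_iff by blast
  then have R: "norm (z k) \<le> R" if "1 \<le> k" for k
    using objective_le that by blast
  have "compact (grad F ` cball 0 R)"
    by (intro compact_continuous_image smooth_continuous_on_grad smooth_F) simp
  then obtain G where "\<And>x. x \<in> cball 0 R \<Longrightarrow> norm (grad F x) \<le> G"
    by (meson bounded_iff compact_imp_bounded image_eqI)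
  then have G: "norm (grad F (z k)) \<le> G" if "1 \<le> k" for k
    using R[OF that] by simp
  define S where "S = max 1 (2 * (\<Theta> (z 1) + G) / \<rho> 1)"
  have S: "norm (step k) \<le> S" if k: "1 \<le> k" for k
  proof (cases "norm (step k) \<le> 1")
    case False
    let ?n = "norm (step k)"
    have "\<rho> 1 / 2 * ?n\<^sup>2 \<le> \<rho> k / 2 * ?n\<^sup>2"
      using proximal_ge[OF k] by (simp add: mult_right_mono)
    also have "\<dots> \<le> \<Theta> (z 1) + norm (grad F (z k)) * ?n"
      using model_lower_bound[of "\<rho> k" "step k" "z k"] step_decrease[OF k] objective_le[OF k]
      by linarith
    \<comment> \<open>As the norm exceeds 1 and the objective is nonnegative, the constant term may
      be multiplied by the norm too; one factor then cancels and leaves the second entry of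
      \<open>S\<close>.\<close>
    also have "\<dots> \<le> \<Theta> (z 1) * ?n + G * ?n"
      using False objective_nonneg[of "z 1"] G[OF k]
      by (intro add_mono mult_right_mono) (auto simp: mult_le_cancel_left1)
    finally have "\<rho> 1 / 2 * ?n * ?n \<le> (\<Theta> (z 1) + G) * ?n"
      by (simp add: power2_eq_square algebra_simps)
    then have "\<rho> 1 / 2 * ?n \<le> \<Theta> (z 1) + G"
      by (rule mult_right_le_imp_le) (use False in linarith)
    then have "?n \<le> 2 * (\<Theta> (z 1) + G) / \<rho> 1"
      using parameters(1) by (simp add: field_simps)
    then show ?thesis
      unfolding S_def by simp
  qed (simp add: S_def)
  show ?thesis
  proof (rule that[of "R + S"])
    fix k :: nat assume k: "1 \<le> k"
    show "z k \<in> cball 0 (R + S)"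
      using R[OF k] unfolding S_def by simp
    show "z k + step k \<in> cball 0 (R + S)"
      using norm_triangle_ineq[of "z k" "step k"] R[OF k] S[OF k] by simp
  qed
qed

section \<open>Success of all late steps\<close>

lemma successful_if_proximal_large:
  obtains B where "\<And>k. \<lbrakk>1 \<le> k; B \<le> \<rho> k\<rbrakk> \<Longrightarrow> successful k"
proof -
  obtain R where R: "\<And>k. 1 \<le> k \<Longrightarrow> z k \<in> cball 0 R" "\<And>k. 1 \<le> k \<Longrightarrow> z k + step k \<in> cball 0 R"
    using bounded_iterates by blast
  obtain M where M: "0 \<le> M" "\<And>x s r. \<lbrakk>x \<in> cball 0 R; x + s \<in> cball 0 R\<rbrakk> \<Longrightarrow>
      \<bar>\<Theta> (x + s) - (model x r s - r / 2 * (norm s)\<^sup>2)\<bar> \<le> M * (norm s)\<^sup>2"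
    using model_error by metis
  \<comment> \<open>The actual decrease is at least
    \<open>(\<rho> k / 2 - M) * (norm (step k))\<^sup>2\<close>. The threshold is the solution for
    \<open>\<rho> k\<close> of
    \<open>\<rho> k / 2 - M \<ge> \<eta>\<^sub>1 * \<rho> k / 2\<close>.\<close>
  have "successful k" if k: "1 \<le> k" and B: "2 * M / (1 - \<eta>\<^sub>1) \<le> \<rho> k" for k
  proof -
    have "\<eta>\<^sub>1 * \<rho> k / 2 \<le> \<rho> k / 2 - M"
      using B parameters(3) by (simp add: field_simps)
    then have "\<eta>\<^sub>1 * \<rho> k / 2 * (norm (step k))\<^sup>2 \<le> (\<rho> k / 2 - M) * (norm (step k))\<^sup>2"
      by (rule mult_right_mono) simp
    also have "\<dots> \<le> \<Theta> (z k) - \<Theta> (z k + step k)"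
      using M(2)[OF R(1)[OF k] R(2)[OF k], of "\<rho> k"] step_decrease[OF k]
      by (simp add: left_diff_distrib)
    finally show ?thesis
      unfolding successful_def .
  qed
  then show ?thesis
    using that by blast
qed

lemma proximal_convergent: "convergent (\<lambda>k. \<rho> (Suc k))"
proof -
  obtain B where B: "\<And>k. \<lbrakk>1 \<le> k; B \<le> \<rho> k\<rbrakk> \<Longrightarrow> successful k"
    using successful_if_proximal_large by blast
  \<comment> \<open>Only a failed step enlarges the parameter, and failure needs a value below
    \<open>B\<close>, so the new value is at most \<open>\<eta>\<^sub>2 * B\<close>. The entry
    \<open>\<rho> 1\<close> covers the start.\<close>
  have "\<rho> k \<le> max (\<rho> 1) (\<eta>\<^sub>2 * B)" if "1 \<le> k" for k
    using that
  proof (induction k rule: dec_induct)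
    case (step k)
    show ?case
    proof (cases "successful k")
      case False
      then have "\<rho> k \<le> B"
        using B step.hyps by force
      then show ?thesis
        using step_unsuccessful[of k] step.hyps False parameters(4)
        by (simp add: max.coboundedI2)
    qed (use step step_successful in auto)
  qed simp
  \<comment> \<open>The shift by \<open>Suc\<close> is there because monotonicity is known only from
    index 1 on.\<close>
  moreover have "incseq (\<lambda>k. \<rho> (Suc k))"
    by (intro incseq_SucI proximal_mono_Suc) simp
  ultimately have "\<exists>l. (\<lambda>k. \<rho> (Suc k)) \<longlonglongrightarrow> l"
    by (metis incseq_convergent le_add1 plus_1_eq_Suc)
  then show ?thesis
    by (simp add: convergent_def)
qed

text \<open>Each failure raises the parameter by at least
  \<open>(\<eta>\<^sub>2 - 1) * \<rho> 1 > 0\<close>, while the increments of a convergent sequence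
  tend to 0.\<close>

lemma eventually_successful: "\<forall>\<^sub>F k in sequentially. successful k"
proof -
  obtain l where "(\<lambda>k. \<rho> (Suc k)) \<longlonglongrightarrow> l"
    using proximal_convergent unfolding convergent_def by blast
  then have "\<rho> \<longlonglongrightarrow> l"
    by (rule LIMSEQ_imp_Suc)
  then have "(\<lambda>k. \<rho> (Suc k) - \<rho> k) \<longlonglongrightarrow> l - l"
    by (intro tendsto_diff) (rule LIMSEQ_Suc)
  moreover have "l - l < (\<eta>\<^sub>2 - 1) * \<rho> 1"
    using parameters by simp
  ultimately have "\<forall>\<^sub>F k in sequentially. \<rho> (Suc k) - \<rho> k < (\<eta>\<^sub>2 - 1) * \<rho> 1"
    by (rule order_tendstoD)
  then show ?thesis
    using eventually_ge_at_top[of 1]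
  proof eventually_elim
    case (elim k)
    show ?case
    proof (rule ccontr)
      assume "\<not> successful k"
      then have "\<rho> (Suc k) - \<rho> k = (\<eta>\<^sub>2 - 1) * \<rho> k"
        using step_unsuccessful[of k] elim by (simp add: algebra_simps)
      moreover have "(\<eta>\<^sub>2 - 1) * \<rho> 1 \<le> (\<eta>\<^sub>2 - 1) * \<rho> k"
        using proximal_ge elim parameters(4) by (intro mult_left_mono) auto
      ultimately show False
        using elim by linarith
    qed
  qed
qed

text \<open>The objective values decrease and are nonnegative, so they converge and their
  differences vanish. At successful steps these differences dominate the squared step norms, with
  the uniform factor \<open>\<eta>\<^sub>1 * \<rho> 1 / 2\<close>.\<close>

lemma steps_tendsto_0: "step \<longlonglongrightarrow> 0"
proof -
  have "decseq (\<lambda>k. \<Theta> (z (Suc k)))"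
    by (intro decseq_SucI objective_decrease_Suc) simp
  then obtain l where "(\<lambda>k. \<Theta> (z (Suc k))) \<longlonglongrightarrow> l"
    using decseq_convergent[of "\<lambda>k. \<Theta> (z (Suc k))" 0] objective_nonneg by blast
  then have l: "(\<lambda>k. \<Theta> (z k)) \<longlonglongrightarrow> l"
    by (rule LIMSEQ_imp_Suc)
  let ?b = "\<lambda>k. 2 / (\<eta>\<^sub>1 * \<rho> 1) * (\<Theta> (z k) - \<Theta> (z (Suc k)))"
  have "?b \<longlonglongrightarrow> 2 / (\<eta>\<^sub>1 * \<rho> 1) * (l - l)"
    by (intro tendsto_intros l LIMSEQ_Suc[OF l])
  then have b: "?b \<longlonglongrightarrow> 0" by simp
  have "\<forall>\<^sub>F k in sequentially. (norm (step k))\<^sup>2 \<le> ?b k"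
    using eventually_successful eventually_ge_at_top[of 1]
  proof eventually_elim
    case (elim k)
    have "\<eta>\<^sub>1 * \<rho> 1 / 2 * (norm (step k))\<^sup>2 \<le> \<eta>\<^sub>1 * \<rho> k / 2 * (norm (step k))\<^sup>2"
      using proximal_ge[of k] elim parameters(2) by (intro mult_right_mono) auto
    also have "\<dots> \<le> \<Theta> (z k) - \<Theta> (z (Suc k))"
      using elim step_successful[of k] by (simp add: successful_def)
    finally show ?case
      using parameters by (simp add: field_simps)
  qed
  then have "(\<lambda>k. (norm (step k))\<^sup>2) \<longlonglongrightarrow> 0"
    by (intro tendsto_sandwich[OF _ _ tendsto_const b]) auto
  then have "(\<lambda>k. sqrt ((norm (step k))\<^sup>2)) \<longlonglongrightarrow> sqrt 0"
    by (rule tendsto_real_sqrt)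
  then show ?thesis
    by (simp add: tendsto_norm_zero_iff)
qed

text \<open>Pieces that contain the accumulation point are eventually active, because the activity
  threshold \<open>\<delta>\<close> is positive.\<close>

lemma accumulation_point_model:
  assumes "accumulation_point z x"
  obtains r where "\<And>i y. \<lbrakk>i \<in> {1..I}; x \<in> P i; y \<in> P i\<rbrakk> \<Longrightarrow> \<Theta> x \<le> model x r (y - x)"
proof -
  obtain q where q: "strict_mono q" "(\<lambda>k. z (q k)) \<longlonglongrightarrow> x"
    using assms unfolding accumulation_point_def by blast
  obtain r where "(\<lambda>k. \<rho> (Suc k)) \<longlonglongrightarrow> r"
    using proximal_convergent unfolding convergent_def by blast
  then have "\<rho> \<longlonglongrightarrow> r"
    by (rule LIMSEQ_imp_Suc)
  then have r: "(\<lambda>k. \<rho> (q k)) \<longlonglongrightarrow> r"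
    using LIMSEQ_subseq_LIMSEQ[OF _ q(1), of \<rho>] unfolding comp_def by blast
  have s: "(\<lambda>k. step (q k)) \<longlonglongrightarrow> 0"
    using LIMSEQ_subseq_LIMSEQ[OF steps_tendsto_0 q(1)] unfolding comp_def .
  have ev: "\<forall>\<^sub>F k in sequentially. 1 \<le> q k"
    using filterlim_subseq[OF q(1)] by (simp add: filterlim_at_top)
  have "\<Theta> x \<le> model x r (y - x)" if i: "i \<in> {1..I}" "x \<in> P i" and y: "y \<in> P i" for i y
  proof -
    have "\<forall>\<^sub>F k in sequentially. dist (z (q k)) x < \<delta>"
      using q(2) parameters(5) by (rule tendstoD)
    then have "\<forall>\<^sub>F k in sequentially.
        model (z (q k)) (\<rho> (q k)) (step (q k)) \<le> model (z (q k)) (\<rho> (q k)) (y - z (q k))"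
      using ev
    proof eventually_elim
      case (elim k)
      have "infdist (z (q k)) (P i) \<le> \<delta>"
        using infdist_le[OF i(2), of "z (q k)"] elim by linarith
      then have "i \<in> active_pieces P I \<delta> (z (q k))"
        using i(1) by (simp add: active_pieces_def)
      then show ?case
        using step_minimal elim y by blast
    qed
    moreover have "(\<lambda>k. y - z (q k)) \<longlonglongrightarrow> y - x"
      by (intro tendsto_intros q)
    \<comment> \<open>A fixed \<open>y\<close> in \<open>P i\<close> is a competitor at all late
      indices of the subsequence, with the moving step \<open>y - z (q k)\<close>. Both sides
      converge by \<open>tendsto_model\<close>.\<close>
    ultimately have "model x r 0 \<le> model x r (y - x)"
      using tendsto_model[OF q(2) r] s tendsto_le[OF trivial_limit_sequentially] by blast
    then show ?thesis
      by (simp add: model_0)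
  qed
  then show ?thesis
    using that by blast
qed

theorem accumulation_point_stationary:
  assumes x: "accumulation_point z x" and D: "has_dir_deriv \<Theta> x d D"
  shows "0 \<le> D"
proof -
  obtain r where r: "\<And>i y. \<lbrakk>i \<in> {1..I}; x \<in> P i; y \<in> P i\<rbrakk> \<Longrightarrow> \<Theta> x \<le> model x r (y - x)"
    using accumulation_point_model[OF x] by blast
  \<comment> \<open>Deleting the finitely many closed pieces that miss \<open>x\<close> leaves an
    open neighbourhood of \<open>x\<close>, in which every point lies in a piece that also contains
    \<open>x\<close>.\<close>
  define U where "U = - (\<Union>i\<in>{1..I} \<inter> {i. x \<notin> P i}. P i)"
  have "open U" "x \<in> U"
    unfolding U_def using closed_P by (auto simp del: Compl_UN intro!: closed_UN open_Compl)
  moreover have "((\<lambda>\<tau>. x + \<tau> *\<^sub>R d) \<longlongrightarrow> x + 0 *\<^sub>R d) (at_right 0)"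
    by (intro tendsto_intros)
  ultimately have "\<forall>\<^sub>F \<tau> in at_right 0. x + \<tau> *\<^sub>R d \<in> U"
    by (simp add: topological_tendstoD)
  then have "\<forall>\<^sub>F \<tau> in at_right 0. \<Theta> x \<le> model x r (\<tau> *\<^sub>R d)"
  proof eventually_elim
    case (elim \<tau>)
    obtain i where i: "i \<in> {1..I}" "x + \<tau> *\<^sub>R d \<in> P i"
      using P_cover by blast
    with elim have "x \<in> P i"
      unfolding U_def by blast
    then show ?case
      using r[OF i(1) _ i(2)] by simp
  qed
  then show ?thesis
    using D by (rule model_local_min_imp_dir_deriv_nonneg)
qed

end

section \<open>The penalty objective\<close>

lemma smooth_add_norm_squared:
  fixes g :: "'b::euclidean_space \<Rightarrow> real"
    and F :: "'a::euclidean_space \<times> 'b \<Rightarrow> real"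
  assumes g: "smooth g" and F: "\<And>a b. F (a, b) = g b + r * (norm a)\<^sup>2"
  shows "smooth F"
proof (rule smoothI)
  \<comment> \<open>The inner product form of the squared norm is differentiable by rule everywhere,
    including at the origin.\<close>
  have F': "F = (\<lambda>x. g (snd x) + r * (fst x \<bullet> fst x))"
    using F by (auto simp: power2_norm_eq_inner)
  have "(g has_derivative (\<lambda>h. h \<bullet> grad g b)) (at b)" for b
    using smooth_GDERIV[OF g] unfolding gderiv_def .
  then have "((\<lambda>x. g (snd x)) has_derivative (\<lambda>h. snd h \<bullet> grad g (snd x))) (at x)" for x :: "'a \<times> 'b"
    by (rule has_derivative_compose[of snd snd, rotated]) (auto intro!: derivative_eq_intros)
  moreover have "((\<lambda>x. r * (fst x \<bullet> fst x)) has_derivative (\<lambda>h. fst h \<bullet> (2 * r) *\<^sub>R fst x)) (at x)"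
    for x :: "'a \<times> 'b"
    by (auto intro!: derivative_eq_intros simp: inner_commute)
  ultimately have "(F has_derivative (\<lambda>h. snd h \<bullet> grad g (snd x) + fst h \<bullet> (2 * r) *\<^sub>R fst x)) (at x)" for x
    unfolding F' by (rule has_derivative_add)
  then show "GDERIV F x :> ((2 * r) *\<^sub>R fst x, grad g (snd x))" for x
    by (simp add: gderiv_def inner_prod_def add.commute)
  have "locally_lipschitz (\<lambda>x :: 'a \<times> 'b. (2 * r) *\<^sub>R fst x)"
    by (intro bounded_linear_imp_locally_lipschitz bounded_linear_intros)
  moreover have "locally_lipschitz (\<lambda>x :: 'a \<times> 'b. grad g (snd x))"
    using g unfolding smooth_def
    by (intro locally_lipschitz_compose[where f = snd and g = "grad g"])
      (auto intro: bounded_linear_imp_locally_lipschitz bounded_linear_snd)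
  ultimately show "locally_lipschitz (\<lambda>x :: 'a \<times> 'b. ((2 * r) *\<^sub>R fst x, grad g (snd x)))"
    by (rule locally_lipschitz_Pair)
qed

text \<open>The shape of the functions \<open>c j\<close>: with a unit vector for \<open>w\<close>,
  the inner product extracts one coordinate of \<open>u\<close>, and \<open>r\<close> is the penalty
  weight.\<close>

lemma smooth_linear_minus_scaled:
  fixes f :: "'a::euclidean_space \<Rightarrow> real"
  assumes f: "smooth f"
  shows "smooth (\<lambda>x. r * (x \<bullet> w - f x))"
proof (rule smoothI)
  have "(f has_derivative (\<lambda>h. h \<bullet> grad f x)) (at x)" for x
    using smooth_GDERIV[OF f] unfolding gderiv_def .
  then show "GDERIV (\<lambda>x. r * (x \<bullet> w - f x)) x :> r *\<^sub>R (w - grad f x)" for x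
    unfolding gderiv_def by (auto intro!: derivative_eq_intros simp: inner_diff_right)
  have "\<bar>r\<bar>-lipschitz_on UNIV (\<lambda>v. r *\<^sub>R (w - v))"
    by (rule lipschitz_onI) (auto simp: dist_norm norm_minus_commute simp flip: scaleR_right_diff_distrib)
  then show "locally_lipschitz (\<lambda>x. r *\<^sub>R (w - grad f x))"
    using f unfolding smooth_def
    by (intro locally_lipschitz_compose[where f = "grad f" and g = "\<lambda>v. r *\<^sub>R (w - v)"])
      (auto intro: lipschitz_imp_locally_lipschitz)
qed

text \<open>The layers partition the coordinates of \<open>u\<close>, and outside layer
  \<open>l\<close> both vectors of the \<open>l\<close>-th term vanish. The layered penalty thus
  becomes a sum over single coordinates, which can be split by the type of the component.\<close>

lemma sum_norm1_layer_part:
  fixes lay :: "'m::finite \<Rightarrow> nat"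
  assumes lay: "range lay = {1..L}" and v: "\<And>l i. \<lbrakk>l \<in> {1..L}; lay i \<noteq> l\<rbrakk> \<Longrightarrow> v l $ i = 0"
  shows "(\<Sum>l=1..L. b l * norm1 (layer_part lay l u - v l)) = (\<Sum>i\<in>UNIV. b (lay i) * \<bar>u $ i - v (lay i) $ i\<bar>)"
proof -
  have "(\<Sum>l=1..L. b l * norm1 (layer_part lay l u - v l))
      = (\<Sum>l=1..L. \<Sum>i\<in>UNIV. if lay i = l then b (lay i) * \<bar>u $ i - v (lay i) $ i\<bar> else 0)"
    using v by (intro sum.cong) (auto simp: norm1_def layer_part_def sum_distrib_left intro!: sum.cong)
  also have "\<dots> = (\<Sum>i\<in>UNIV. \<Sum>l=1..L. if lay i = l then b (lay i) * \<bar>u $ i - v (lay i) $ i\<bar> else 0)"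
    by (rule sum.swap)
  also have "\<dots> = (\<Sum>i\<in>UNIV. b (lay i) * \<bar>u $ i - v (lay i) $ i\<bar>)"
    using lay by (intro sum.cong) auto
  finally show ?thesis .
qed

text \<open>Existence of the directional derivative is part of the conclusion, so the inequality
  does not rest on an unspecified value of \<open>dir_deriv\<close>.\<close>

theorem theorem3p2:
  fixes L :: nat
    and lay :: "'m::finite \<Rightarrow> nat"
    and g :: "real^'m \<Rightarrow> real"
    and \<psi> :: "nat \<Rightarrow> (real^'n::finite) \<times> (real^'m) \<Rightarrow> real^'m"
    and lam :: real
    and \<beta> :: "nat \<Rightarrow> real"
    and F \<Theta> H :: "(real^'n) \<times> (real^'m) \<Rightarrow> real"
    and J :: nat
    and idx :: "nat \<Rightarrow> 'm"
    and c :: "nat \<Rightarrow> (real^'n) \<times> (real^'m) \<Rightarrow> real"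
    and I :: nat
    and P :: "nat \<Rightarrow> ((real^'n) \<times> (real^'m)) set"
    and \<eta>\<^sub>1 \<eta>\<^sub>2 \<delta> :: real
    and z :: "nat \<Rightarrow> (real^'n) \<times> (real^'m)"
    and \<rho> :: "nat \<Rightarrow> real"
    and zbar :: "(real^'n) \<times> (real^'m)"
  assumes layers: "range lay = {1..L}"
    and \<psi>_layer: "\<And>l. l \<in> {1..L} \<Longrightarrow> layer_function lay l (\<psi> (l - 1))"
    and g_nonneg: "\<And>u. 0 \<le> g u"
    and g_regular: "locally_lipschitz g" "twice_dir_differentiable g"
    and \<psi>_regular: "\<And>l. l \<in> {1..L} \<Longrightarrow> locally_lipschitz (\<psi> (l - 1))"
        "\<And>l. l \<in> {1..L} \<Longrightarrow> twice_dir_differentiable (\<psi> (l - 1))"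
    and lam_pos: "0 < lam"
    and \<beta>_pos: "\<And>l. l \<in> {1..L} \<Longrightarrow> 0 < \<beta> l"
    and F_def: "\<And>\<theta> u. F (\<theta>, u) = g u + lam * (norm \<theta>)\<^sup>2"
    and \<Theta>_def: "\<And>\<theta> u. \<Theta> (\<theta>, u) =
          F (\<theta>, u) + (\<Sum>l=1..L. \<beta> l * norm1 (layer_part lay l u - \<psi> (l - 1) (\<theta>, u)))"
    and g_smooth: "smooth g"
    and \<psi>_components: "\<And>l i. \<lbrakk>l \<in> {1..L}; lay i = l\<rbrakk> \<Longrightarrow>
          smooth (\<lambda>z. \<psi> (l - 1) z $ i) \<or> piecewise_affine (\<lambda>z. \<psi> (l - 1) z $ i)"
    and H_def: "\<And>\<theta> u. H (\<theta>, u) =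
          (\<Sum>i | piecewise_affine (\<lambda>z. \<psi> (lay i - 1) z $ i).
             \<beta> (lay i) * \<bar>u $ i - \<psi> (lay i - 1) (\<theta>, u) $ i\<bar>)"
    and idx: "bij_betw idx {1..J} {i. \<not> piecewise_affine (\<lambda>z. \<psi> (lay i - 1) z $ i)}"
    and c_def: "\<And>j \<theta> u. j \<in> {1..J} \<Longrightarrow> c j (\<theta>, u) =
          \<beta> (lay (idx j)) * (u $ idx j - \<psi> (lay (idx j) - 1) (\<theta>, u) $ idx j)"
    and P_polyhedra: "\<And>i. i \<in> {1..I} \<Longrightarrow> polyhedron (P i) \<and> P i \<noteq> {}"
    and P_distinct: "inj_on P {1..I}"
    and P_cover: "(\<Union>i\<in>{1..I}. P i) = UNIV"
    and H_affine: "\<And>i. i \<in> {1..I} \<Longrightarrow> affine_fun_on (P i) H"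
    and \<Theta>_level_bounded: "level_bounded \<Theta>"
    and run: "srpa_infinite_run F H J c \<Theta> P I \<eta>\<^sub>1 \<eta>\<^sub>2 \<delta> z \<rho>"
    and zbar: "accumulation_point z zbar"
  shows "\<forall>d. \<exists>D. has_dir_deriv \<Theta> zbar d D \<and> 0 \<le> D"
proof
  fix d
  let ?h = "\<lambda>i x. snd x $ i - \<psi> (lay i - 1) x $ i"
  let ?A = "{i. piecewise_affine (\<lambda>z. \<psi> (lay i - 1) z $ i)}"
  have lay: "lay i \<in> {1..L}" for i
    using layers by blast
  have \<beta>: "0 < \<beta> (lay i)" for i
    using \<beta>_pos lay by blast
  have \<psi>_0: "\<psi> (l - 1) x $ i = 0" if "l \<in> {1..L}" "lay i \<noteq> l" for l i x
    using \<psi>_layer[OF that(1)] that(2) unfolding layer_function_def by blast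
  have \<Theta>_eq: "\<Theta> x = F x + (\<Sum>i\<in>UNIV. \<beta> (lay i) * \<bar>?h i x\<bar>)" for x
    using sum_norm1_layer_part[OF layers, of "\<lambda>l. \<psi> (l - 1) x" \<beta> "snd x", OF \<psi>_0]
      \<Theta>_def[of "fst x" "snd x"] by simp
  have H_eq: "H x = (\<Sum>i\<in>?A. \<beta> (lay i) * \<bar>?h i x\<bar>)" for x
    using H_def[of "fst x" "snd x"] by simp
  have c_eq: "c j = (\<lambda>x. \<beta> (lay (idx j)) * ?h (idx j) x)" if "j \<in> {1..J}" for j
    using c_def[OF that] by auto
  have F: "smooth F"
    using g_smooth F_def by (rule smooth_add_norm_squared)
  interpret srpa_run F H J c \<Theta> P I \<eta>\<^sub>1 \<eta>\<^sub>2 \<delta> z \<rho>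
  proof
    show "smooth F" by (rule F)
    show "0 \<le> F x" for x
      using F_def[of "fst x" "snd x"] g_nonneg[of "snd x"] lam_pos by simp
    have "continuous_on UNIV (\<psi> (lay i - 1))" for i
      using \<psi>_regular(1)[OF lay] by (rule locally_lipschitz_continuous_on)
    then show "continuous_on UNIV H"
      unfolding H_eq by (intro continuous_intros)
    show "0 \<le> H x" for x
      unfolding H_eq using \<beta> by (intro sum_nonneg mult_nonneg_nonneg) (auto simp: less_imp_le)
    show "smooth (c j)" if j: "j \<in> {1..J}" for j
    proof -
      let ?i = "idx j"
      \<comment> \<open>A component that is both smooth and piecewise affine is counted in
        \<open>H\<close>; \<open>idx\<close> enumerates exactly the remaining ones, which are smooth
        by the dichotomy.\<close>
      have "\<not> piecewise_affine (\<lambda>z. \<psi> (lay ?i - 1) z $ ?i)"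
        using idx j by (auto simp: bij_betw_def)
      then have "smooth (\<lambda>z. \<psi> (lay ?i - 1) z $ ?i)"
        using \<psi>_components[OF lay refl] by blast
      then have "smooth (\<lambda>x. \<beta> (lay ?i) * (x \<bullet> (0, axis ?i 1) - \<psi> (lay ?i - 1) x $ ?i))"
        by (rule smooth_linear_minus_scaled)
      then show ?thesis
        unfolding c_eq[OF j] by (simp add: inner_prod_def inner_axis)
    qed
    show "\<Theta> x = F x + H x + (\<Sum>j=1..J. \<bar>c j x\<bar>)" for x
    proof -
      \<comment> \<open>Positivity of the weights moves them out of the absolute values;
        \<open>idx\<close> then reindexes the sum over the complement of \<open>?A\<close>.\<close>
      have "(\<Sum>j=1..J. \<bar>c j x\<bar>) = (\<Sum>j=1..J. \<beta> (lay (idx j)) * \<bar>?h (idx j) x\<bar>)"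
        using \<beta> by (intro sum.cong refl) (simp add: c_eq abs_mult abs_of_pos)
      also have "\<dots> = (\<Sum>i\<in>- ?A. \<beta> (lay i) * \<bar>?h i x\<bar>)"
        using idx unfolding Collect_neg_eq by (rule sum.reindex_bij_betw)
      finally show ?thesis
        unfolding \<Theta>_eq H_eq
        using sum.subset_diff[of ?A UNIV "\<lambda>i. \<beta> (lay i) * \<bar>?h i x\<bar>"] by (simp add: Compl_eq_Diff_UNIV)
    qed
    show "closed (P i)" if "i \<in> {1..I}" for i
      using P_polyhedra[OF that] polyhedron_imp_closed by blast
  qed (fact P_cover \<Theta>_level_bounded run)+
  \<comment> \<open>What remains is existence of the directional derivative of
    \<open>\<Theta>\<close>. It is obtained coordinate by coordinate, since each penalty term is a
    weighted absolute value of a directionally differentiable residual.\<close>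
  have "\<forall>i. \<exists>D. has_dir_deriv (\<lambda>x. \<beta> (lay i) * \<bar>?h i x\<bar>) zbar d D"
  proof
    fix i
    obtain D where "has_dir_deriv (\<psi> (lay i - 1)) zbar d D"
      using \<psi>_regular(2)[OF lay] unfolding twice_dir_differentiable_def by blast
    then have \<psi>': "has_dir_deriv (\<lambda>x. - (\<psi> (lay i - 1) x $ i)) zbar d (- (D $ i))"
      by (rule has_dir_deriv_bounded_linear[rotated]) (intro bounded_linear_minus bounded_linear_vec_nth)
    have "has_dir_deriv (\<lambda>x. snd x $ i) zbar d (snd d $ i)"
      by (intro has_derivative_imp_has_dir_deriv bounded_linear_imp_has_derivative
          bounded_linear_compose[OF bounded_linear_vec_nth bounded_linear_snd])
    then have "has_dir_deriv (?h i) zbar d (snd d $ i + - (D $ i))"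
      using has_dir_deriv_add[OF _ \<psi>'] by simp
    then obtain E where "has_dir_deriv (\<lambda>x. \<bar>?h i x\<bar>) zbar d E"
      by (rule has_dir_deriv_abs)
    then have "has_dir_deriv (\<lambda>x. \<beta> (lay i) * \<bar>?h i x\<bar>) zbar d (\<beta> (lay i) * E)"
      by (rule has_dir_deriv_bounded_linear[rotated]) (rule bounded_linear_mult_right)
    then show "\<exists>D. has_dir_deriv (\<lambda>x. \<beta> (lay i) * \<bar>?h i x\<bar>) zbar d D" ..
  qed
  from choice[OF this] obtain D where
    "\<forall>i. has_dir_deriv (\<lambda>x. \<beta> (lay i) * \<bar>?h i x\<bar>) zbar d (D i)" ..
  then have "has_dir_deriv (\<lambda>x. \<Sum>i\<in>UNIV. \<beta> (lay i) * \<bar>?h i x\<bar>) zbar d (\<Sum>i\<in>UNIV. D i)"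
    by (intro has_dir_deriv_sum) simp
  moreover have "has_dir_deriv F zbar d (d \<bullet> grad F zbar)"
    using smooth_GDERIV[OF F] unfolding gderiv_def by (rule has_derivative_imp_has_dir_deriv)
  ultimately have "has_dir_deriv \<Theta> zbar d (d \<bullet> grad F zbar + (\<Sum>i\<in>UNIV. D i))"
    unfolding \<Theta>_eq[abs_def] by (intro has_dir_deriv_add)
  then show "\<exists>D. has_dir_deriv \<Theta> zbar d D \<and> 0 \<le> D"
    using accumulation_point_stationary[OF zbar] by blast
qed

end
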